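(* Let $n\ge 2$, $k\in\{1,\dots,n-1\}$, $r:=\binom{n}{k}$, and $A\in\mathbb{C}^{n\times n}$. Let $U=U(k,n)\in\{-1,0,1\}^{r\times r}$ be the signed anti-diagonal matrix with $u_{ij}=s(\alpha^j)$ if $i+j=r+1$ and $u_{ij}=0$ otherwise. Then $$ (A^{[k]})^T+U^T A^{[n-k]}U=\operatorname{tr}(A)\, I_r . $$
   Context: $Q(k,n)$ denotes the list $\alpha^1,\dots,\alpha^r$ of all $r=\binom{n}{k}$ increasing sequences of $k$ integers from $\{1,\dots,n\}$, ordered lexicographically. For a square matrix $B$ of size $n$, the $k$-multiplicative compound $B^{(k)}$ is the $\binom{n}{k}\times\binom{n}{k}$ matrix whose $(i,j)$ entry is the minor $B(\alpha^i|\alpha^j)$, the determinant of the submatrix of $B$ with rows $\alpha^i$ and columns $\alpha^j$. The $k$-additive compound is $A^{[k]}:=\frac{d}{d\varepsilon}(I_n+\varepsilon A)^{(k)}\big|_{\varepsilon=0}$. $A^{[n-k]}$ is defined in the same way using the lexicographic order on $Q(n-k,n)$. The signature of $\alpha^j=(\alpha^j_1,\dots,\alpha^j_k)\in Q(k,n)$ is $s(\alpha^j):=(-1)^{\alpha^j_1+\dots+\alpha^j_k}$. *)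

theory Defs
  imports
    "HOL-Analysis.Derivative"
    "HOL-Library.List_Lexorder"
    "Jordan_Normal_Form.Determinant"
begin

text \<open>
  The list \<open>Q(k,n)\<close>. Its members are sequences of integers from \<open>{1..n}\<close>, so they are one-based,
  whereas positions in lists and matrix indices are zero-based.
  The order on lists is the lexicographic one of \<^theory>\<open>HOL-Library.List_Lexorder\<close>.
\<close>

definition inc_seqs :: "nat \<Rightarrow> nat \<Rightarrow> nat list list" where
  "inc_seqs k n =
     sorted_list_of_set {\<alpha>. length \<alpha> = k \<and> set \<alpha> \<subseteq> {1..n} \<and> sorted_wrt (<) \<alpha>}"

lemma finite_inc_seqs:
  "finite {\<alpha> :: nat list. length \<alpha> = k \<and> set \<alpha> \<subseteq> {1..n} \<and> sorted_wrt (<) \<alpha>}"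
  by (rule finite_subset[OF _ finite_lists_length_eq[of "{1..n}" k]]) auto

lemma set_inc_seqs:
  "set (inc_seqs k n) = {\<alpha>. length \<alpha> = k \<and> set \<alpha> \<subseteq> {1..n} \<and> sorted_wrt (<) \<alpha>}"
  unfolding inc_seqs_def using finite_inc_seqs by (rule set_sorted_list_of_set)

lemma length_inc_seqs: "length (inc_seqs k n) = n choose k"
proof -
  let ?S = "{\<alpha> :: nat list. length \<alpha> = k \<and> set \<alpha> \<subseteq> {1..n} \<and> sorted_wrt (<) \<alpha>}"
  have "bij_betw set ?S {B. B \<subseteq> {1..n} \<and> card B = k}"
    unfolding bij_betw_def
  proof (intro conjI)
    show "inj_on set ?S"
      by (rule inj_onI) (auto intro: strict_sorted_equal)
    show "set ` ?S = {B. B \<subseteq> {1..n} \<and> card B = k}"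
    proof (intro equalityI subsetI)
      fix B assume "B \<in> {B. B \<subseteq> {1..n} \<and> card B = k}"
      moreover from this have "finite B" by (auto intro: finite_subset)
      ultimately show "B \<in> set ` ?S"
        by (intro image_eqI[where x = "sorted_list_of_set B"]) auto
    qed (auto simp: strict_sorted_iff distinct_card)
  qed
  then have "card ?S = n choose k"
    using n_subsets[of "{1..n}" k] by (simp add: bij_betw_same_card)
  then show ?thesis by (simp add: inc_seqs_def)
qed

definition seq_minor :: "'a :: comm_ring_1 mat \<Rightarrow> nat list \<Rightarrow> nat list \<Rightarrow> 'a" where
  "seq_minor B \<alpha> \<beta> = det (mat (length \<alpha>) (length \<beta>) (\<lambda>(p, q). B $$ (\<alpha> ! p - 1, \<beta> ! q - 1)))"

definition mult_compound :: "nat \<Rightarrow> 'a :: comm_ring_1 mat \<Rightarrow> 'a mat" where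
  "mult_compound k B =
     (let n = dim_row B in
      mat (n choose k) (n choose k) (\<lambda>(i, j). seq_minor B (inc_seqs k n ! i) (inc_seqs k n ! j)))"

text \<open>The derivative of the matrix-valued function is taken entrywise.\<close>

definition add_compound :: "nat \<Rightarrow> complex mat \<Rightarrow> complex mat" where
  "add_compound k A =
     (let n = dim_row A in
      mat (n choose k) (n choose k)
        (\<lambda>(i, j). deriv (\<lambda>\<epsilon>. mult_compound k (1\<^sub>m n + \<epsilon> \<cdot>\<^sub>m A) $$ (i, j)) 0))"

text \<open>The derivatives above exist, so \<^const>\<open>deriv\<close> does not pick an unspecified value.\<close>

lemma add_compound_entry_has_derivative:
  assumes "A \<in> carrier_mat n n" "k \<le> n" "i < n choose k" "j < n choose k"
  shows "((\<lambda>\<epsilon>. mult_compound k (1\<^sub>m n + \<epsilon> \<cdot>\<^sub>m A) $$ (i, j))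
            has_field_derivative add_compound k A $$ (i, j)) (at 0)"
proof -
  have seq: "length (inc_seqs k n ! l) = k"
      "\<And>p. p < k \<Longrightarrow> inc_seqs k n ! l ! p - 1 < n" if "l < n choose k" for l
  proof -
    have l: "inc_seqs k n ! l \<in> set (inc_seqs k n)"
      using that by (simp add: length_inc_seqs)
    show len: "length (inc_seqs k n ! l) = k" using l by (simp add: set_inc_seqs)
    fix p assume "p < k"
    then have "inc_seqs k n ! l ! p \<in> set (inc_seqs k n ! l)" by (simp add: len)
    then have "inc_seqs k n ! l ! p \<in> {1..n}" using l by (auto simp: set_inc_seqs)
    then show "inc_seqs k n ! l ! p - 1 < n" by auto
  qed
  let ?a = "inc_seqs k n ! i" and ?b = "inc_seqs k n ! j"
  let ?e = "\<lambda>r c \<epsilon>. (if r = c then 1 else 0) + \<epsilon> * A $$ (r, c)"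
  have eq: "mult_compound k (1\<^sub>m n + \<epsilon> \<cdot>\<^sub>m A) $$ (i, j) =
      (\<Sum>\<pi> | \<pi> permutes {0..<k}. signof \<pi> * (\<Prod>p = 0..<k. ?e (?a ! p - 1) (?b ! \<pi> p - 1) \<epsilon>))" for \<epsilon>
  proof -
    have *: "\<pi> p < k" if "\<pi> permutes {0..<k}" "p < k" for \<pi> p
      using permutes_in_image[OF that(1), of p] that(2) by simp
    show ?thesis
      using assms seq[OF assms(3)] seq[OF assms(4)]
      by (auto simp: mult_compound_def Let_def seq_minor_def det_def *
               intro!: sum.cong prod.cong arg_cong2[where f = "(*)"])
  qed
  have "(\<lambda>\<epsilon>. mult_compound k (1\<^sub>m n + \<epsilon> \<cdot>\<^sub>m A) $$ (i, j)) field_differentiable at 0"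
    unfolding eq
  proof (intro field_differentiable_sum field_differentiable_mult field_differentiable_const)
    fix \<pi>
    have e: "?e r c field_differentiable at 0" for r c
      by (auto intro!: derivative_intros)
    have "(\<lambda>\<epsilon>. \<Prod>p\<in>P. ?e (?a ! p - 1) (?b ! \<pi> p - 1) \<epsilon>) field_differentiable at 0"
      if "finite P" for P
      using that
    proof (induction P)
      case (insert x P)
      then show ?case
        unfolding prod.insert[OF insert.hyps] by (intro field_differentiable_mult e)
    qed simp
    then show "(\<lambda>\<epsilon>. \<Prod>p = 0..<k. ?e (?a ! p - 1) (?b ! \<pi> p - 1) \<epsilon>) field_differentiable at 0"
      by simp
  qed
  then show ?thesis
    using assms by (simp add: add_compound_def Let_def DERIV_deriv_iff_field_differentiable)
qed

definition seq_sign :: "nat list \<Rightarrow> complex" where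
  "seq_sign \<alpha> = (- 1) ^ sum_list \<alpha>"

text \<open>
  With zero-based \<open>i\<close> and \<open>j\<close>, the anti-diagonal condition \<open>i + j = r + 1\<close> applies to
  \<open>Suc i\<close> and \<open>Suc j\<close>.
\<close>

definition signed_antidiag :: "nat \<Rightarrow> nat \<Rightarrow> complex mat" where
  "signed_antidiag k n =
     (let r = n choose k in
      mat r r (\<lambda>(i, j). if Suc i + Suc j = r + 1 then seq_sign (inc_seqs k n ! j) else 0))"

definition mat_trace :: "'a :: comm_monoid_add mat \<Rightarrow> 'a" where
  "mat_trace A = (\<Sum>i < dim_row A. A $$ (i, i))"

end

theory Submission
  imports Defs
begin

text \<open>
  By Jacobi's formula, the derivative of a minor of \<open>I + \<epsilon> A\<close> at \<open>0\<close> is a sum of entries of \<open>A\<close> times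
  cofactors of a submatrix of \<open>I\<close>, and a minor of \<open>I\<close> on increasing index sequences is \<open>1\<close> if these
  coincide and \<open>0\<close> otherwise. Thus the entry of \<open>A\<^sup>[\<^sup>k\<^sup>]\<close> at index sets \<open>(S, T)\<close> is the sum of
  \<open>\<plusminus> a\<^sub>x\<^sub>y\<close> over the \<open>x \<in> S\<close>, \<open>y \<in> T\<close> with \<open>S - {x} = T - {y}\<close>.
  The lexicographic order of two sets of equal size is decided by which one contains the least element
  of their symmetric difference, so complementation reverses it, and conjugation by \<open>U\<close> pairs the
  entry at \<open>(T, S)\<close> with that of \<open>A\<^sup>[\<^sup>n\<^sup>-\<^sup>k\<^sup>]\<close> at the complements of \<open>(S, T)\<close>. The same pairs \<open>(x, y)\<close>
  contribute to both off the diagonal, with opposite signs; on the diagonal the two sums together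
  give the trace.
\<close>

section \<open>Jacobi's formula and minors of the identity\<close>

text \<open>The product rule on the Leibniz expansion, regrouped by the differentiated row, gives
  determinants in which one row of \<open>M x\<close> is replaced by derivatives. Laplace expansion
  along that row yields the cofactors.\<close>

lemma det_has_field_derivative:
  fixes M :: "'a :: real_normed_field \<Rightarrow> 'a mat"
  assumes M: "\<And>e. M e \<in> carrier_mat m m"
    and D: "\<And>p q. p < m \<Longrightarrow> q < m \<Longrightarrow> ((\<lambda>e. M e $$ (p, q)) has_field_derivative D p q) (at x)"
  shows "((\<lambda>e. det (M e)) has_field_derivative (\<Sum>p<m. \<Sum>q<m. D p q * cofactor (M x) p q)) (at x)"
proof -
  define R where "R = (\<lambda>p. mat m m (\<lambda>(i, q). if i = p then D i q else M x $$ (i, q)))"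
  have R: "R p \<in> carrier_mat m m" for p
    by (simp add: R_def)
  have perm: "\<pi> i < m" if "\<pi> permutes {0..<m}" "i < m" for \<pi> i
    using permutes_in_image[OF that(1), of i] that(2) by simp
  let ?P = "{\<pi>. \<pi> permutes {0..<m}}"
  have "((\<lambda>e. \<Sum>\<pi>\<in>?P. signof \<pi> * (\<Prod>i = 0..<m. M e $$ (i, \<pi> i))) has_field_derivative
      (\<Sum>\<pi>\<in>?P. signof \<pi> * (\<Sum>i = 0..<m. D i (\<pi> i) * (\<Prod>j\<in>{0..<m} - {i}. M x $$ (j, \<pi> j))))) (at x)"
    by (intro DERIV_sum DERIV_cmult has_field_derivative_prod D) (auto intro: perm)
  also have "(\<lambda>e. \<Sum>\<pi>\<in>?P. signof \<pi> * (\<Prod>i = 0..<m. M e $$ (i, \<pi> i))) = (\<lambda>e. det (M e))"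
    by (simp add: det_def'[OF M])
  also have "(\<Sum>\<pi>\<in>?P. signof \<pi> * (\<Sum>i = 0..<m. D i (\<pi> i) * (\<Prod>j\<in>{0..<m} - {i}. M x $$ (j, \<pi> j))))
      = (\<Sum>i = 0..<m. \<Sum>\<pi>\<in>?P. signof \<pi> * (D i (\<pi> i) * (\<Prod>j\<in>{0..<m} - {i}. M x $$ (j, \<pi> j))))"
    unfolding sum_distrib_left by (rule sum.swap)
  also have "\<dots> = (\<Sum>i<m. det (R i))"
    unfolding atLeast0LessThan[symmetric]
  proof (intro sum.cong refl)
    fix i assume i: "i \<in> {0..<m}"
    have "D i (\<pi> i) * (\<Prod>j\<in>{0..<m} - {i}. M x $$ (j, \<pi> j)) = (\<Prod>j = 0..<m. R i $$ (j, \<pi> j))"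
      if "\<pi> \<in> ?P" for \<pi>
      unfolding prod.remove[OF finite_atLeastLessThan i] using that i perm
      by (auto simp: R_def intro!: arg_cong2[where f = "(*)"] prod.cong)
    then show "(\<Sum>\<pi>\<in>?P. signof \<pi> * (D i (\<pi> i) * (\<Prod>j\<in>{0..<m} - {i}. M x $$ (j, \<pi> j)))) = det (R i)"
      by (simp add: det_def'[OF R])
  qed
  also have "\<dots> = (\<Sum>p<m. \<Sum>q<m. D p q * cofactor (M x) p q)"
  proof (intro sum.cong refl)
    fix p assume p: "p \<in> {..<m}"
    \<comment> \<open>Row \<open>p\<close>, the only one in which \<open>R p\<close> and
      \<open>M x\<close> can differ, is deleted.\<close>
    have "mat_delete (R p) p q = mat_delete (M x) p q" for q
      using M[of x] by (auto simp: R_def mat_delete_def intro!: eq_matI)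
    then show "det (R p) = (\<Sum>q<m. D p q * cofactor (M x) p q)"
      using p by (subst laplace_expansion_row[OF R]) (auto simp: cofactor_def R_def)
  qed
  finally show ?thesis .
qed

text \<open>If the images agree, \<open>f\<close> and \<open>g\<close> both enumerate the same set
  in increasing order, so the matrix is the identity. Otherwise equal cardinalities leave some
  \<open>f i\<close> outside the image of \<open>g\<close>, and row \<open>i\<close> is
  zero.\<close>

lemma det_strict_mono_incidence:
  fixes f g :: "nat \<Rightarrow> 'b :: linorder"
  assumes f: "strict_mono_on {..<m} f" and g: "strict_mono_on {..<m} g"
  shows "det (mat m m (\<lambda>(i, j). of_bool (f i = g j))) =
    (of_bool (f ` {..<m} = g ` {..<m}) :: 'a :: comm_ring_1)" (is "det ?M = _")
proof (cases "f ` {..<m} = g ` {..<m}")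
  case True
  have "map f [0..<m] = map g [0..<m]"
    using f g True
    by (intro strict_sorted_equal)
      (auto simp: sorted_wrt_map sorted_wrt_iff_nth_less strict_mono_on_def atLeast0LessThan)
  then have "f i = g i" if "i < m" for i
    using that by (auto simp: map_eq_conv)
  moreover have "inj_on g {..<m}"
    using g by (rule strict_mono_on_imp_inj_on)
  ultimately have "?M = 1\<^sub>m m"
    by (intro eq_matI) (auto dest: inj_onD)
  then show ?thesis
    using True by simp
next
  case False
  have "card (f ` {..<m}) = card (g ` {..<m})"
    using f g by (simp add: card_image strict_mono_on_imp_inj_on)
  then have "\<not> f ` {..<m} \<subseteq> g ` {..<m}"
    using False card_subset_eq[of "g ` {..<m}" "f ` {..<m}"] by auto
  then obtain i where i: "i < m" "f i \<notin> g ` {..<m}"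
    by auto
  then have "det ?M = 0"
    by (subst laplace_expansion_row[of _ m i]) (auto intro!: sum.neutral)
  then show ?thesis
    using False by simp
qed

lemma nth_insert_index_image:
  assumes "distinct xs" "p < length xs"
  shows "(\<lambda>i. xs ! insert_index p i) ` {..<length xs - 1} = set xs - {xs ! p}"
proof -
  have "insert_index p ` {..<length xs - 1} = {..<length xs} - {p}"
    using insert_index_image[of p "length xs - 1"] assms(2)
    by (cases "length xs") (simp_all add: atLeast0LessThan)
  then have "(\<lambda>i. xs ! insert_index p i) ` {..<length xs - 1} = (!) xs ` ({..<length xs} - {p})"
    by (metis image_image)
  also have "\<dots> = (!) xs ` {..<length xs} - (!) xs ` {p}"
    using assms by (intro inj_on_image_set_diff[of _ "{..<length xs}"])
      (auto intro: inj_on_nth)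
  also have "(!) xs ` {..<length xs} = set xs"
    by (metis atLeast0LessThan map_nth set_map set_upt)
  finally show ?thesis
    by simp
qed

text \<open>Deleting a row and a column leaves the incidence matrix of two shorter strictly
  increasing sequences, to which \<open>det_strict_mono_incidence\<close> applies.\<close>

lemma cofactor_strict_sorted_incidence:
  fixes \<alpha> \<beta> :: "'b :: linorder list"
  assumes "sorted_wrt (<) \<alpha>" "sorted_wrt (<) \<beta>" "length \<alpha> = m" "length \<beta> = m" "p < m" "q < m"
  shows "cofactor (mat m m (\<lambda>(i, j). of_bool (\<alpha> ! i = \<beta> ! j))) p q =
    (- 1) ^ (p + q) * (of_bool (set \<alpha> - {\<alpha> ! p} = set \<beta> - {\<beta> ! q}) :: 'a :: comm_ring_1)"
proof -
  let ?f = "\<lambda>\<gamma> p i. \<gamma> ! insert_index p i"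
  have mono: "strict_mono_on {..<m - 1} (?f \<gamma> p)" if "sorted_wrt (<) \<gamma>" "length \<gamma> = m"
    for \<gamma> :: "'b list" and p
    using that by (auto simp: strict_mono_on_def insert_index_def sorted_wrt_iff_nth_less)
  have "mat_delete (mat m m (\<lambda>(i, j). of_bool (\<alpha> ! i = \<beta> ! j))) p q =
      mat (m - 1) (m - 1) (\<lambda>(i, j). of_bool (?f \<alpha> p i = ?f \<beta> q j) :: 'a)"
    using assms by (auto simp: mat_delete_def insert_index_def intro!: eq_matI)
  moreover have "distinct \<alpha>" "distinct \<beta>"
    using assms by (simp_all add: strict_sorted_iff)
  ultimately have "det (mat_delete (mat m m (\<lambda>(i, j). of_bool (\<alpha> ! i = \<beta> ! j))) p q) =
      (of_bool (set \<alpha> - {\<alpha> ! p} = set \<beta> - {\<beta> ! q}) :: 'a)"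
    using assms nth_insert_index_image[of \<alpha> p] nth_insert_index_image[of \<beta> q]
      det_strict_mono_incidence[OF mono[of \<alpha> p] mono[of \<beta> q]]
    by simp
  then show ?thesis
    by (simp add: cofactor_def)
qed

text \<open>Turns the list positions in the cofactor signs into ranks within sets.\<close>

lemma card_less_nth:
  fixes xs :: "'a :: linorder list"
  assumes "sorted_wrt (<) xs" "p < length xs"
  shows "card {z \<in> set xs. z < xs ! p} = p"
proof -
  have mono: "xs ! i < xs ! j" if "i < j" "j < length xs" for i j
    using assms(1) that by (simp add: sorted_wrt_iff_nth_less)
  have "{z \<in> set xs. z < xs ! p} = (!) xs ` {..<p}"
  proof (intro equalityI subsetI)
    fix z assume "z \<in> {z \<in> set xs. z < xs ! p}"
    then obtain i where i: "i < length xs" "z = xs ! i" "xs ! i < xs ! p"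
      by (auto simp: in_set_conv_nth)
    then have "i < p"
      using mono[of p i] assms(2) by (metis less_asym linorder_neqE_nat order_less_irrefl)
    then show "z \<in> (!) xs ` {..<p}"
      using i by blast
  qed (use mono assms(2) in auto)
  moreover have "inj_on ((!) xs) {..<p}"
    using assms by (intro inj_on_nth) (auto simp: strict_sorted_iff)
  ultimately show ?thesis
    by (simp add: card_image)
qed

section \<open>Entries of the additive compound in terms of index sets\<close>

text \<open>Ranks replace list positions in the sign, so that complements can be taken without
  lists. The elements are one-based, the matrix indices zero-based.\<close>

definition add_compound_coeff :: "nat set \<Rightarrow> nat set \<Rightarrow> 'a :: comm_ring_1 mat \<Rightarrow> 'a" where
  "add_compound_coeff S T A = (\<Sum>x\<in>S. \<Sum>y\<in>T.
     if S - {x} = T - {y}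
     then (- 1) ^ (card {z \<in> S. z < x} + card {z \<in> T. z < y}) * A $$ (x - 1, y - 1) else 0)"

lemma inc_seqs_nth:
  assumes "i < n choose k"
  shows "length (inc_seqs k n ! i) = k" "set (inc_seqs k n ! i) \<subseteq> {1..n}"
    "sorted_wrt (<) (inc_seqs k n ! i)"
proof -
  have "inc_seqs k n ! i \<in> set (inc_seqs k n)"
    using assms by (simp add: length_inc_seqs)
  then show "length (inc_seqs k n ! i) = k" "set (inc_seqs k n ! i) \<subseteq> {1..n}"
    "sorted_wrt (<) (inc_seqs k n ! i)"
    by (simp_all add: set_inc_seqs)
qed

text \<open>Jacobi's formula is applied at \<open>0\<close>, where the matrix of the minor is an
  incidence matrix with known cofactors. The sums over positions are then reindexed by
  elements.\<close>

lemma add_compound_index: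
  assumes A: "A \<in> carrier_mat n n" and i: "i < n choose k" and j: "j < n choose k"
  shows "add_compound k A $$ (i, j) =
    add_compound_coeff (set (inc_seqs k n ! i)) (set (inc_seqs k n ! j)) A"
proof -
  define \<alpha> \<beta> where "\<alpha> = inc_seqs k n ! i" and "\<beta> = inc_seqs k n ! j"
  note \<alpha> = inc_seqs_nth[OF i, folded \<alpha>_def] and \<beta> = inc_seqs_nth[OF j, folded \<beta>_def]
  have \<alpha>_range: "0 < \<alpha> ! p" "\<alpha> ! p \<le> n" if "p < k" for p
    using \<alpha> that nth_mem[of p \<alpha>] by fastforce+
  have \<beta>_range: "0 < \<beta> ! p" "\<beta> ! p \<le> n" if "p < k" for p
    using \<beta> that nth_mem[of p \<beta>] by fastforce+
  define M where "M = (\<lambda>\<epsilon>. mat k k (\<lambda>(p, q).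
    of_bool (\<alpha> ! p = \<beta> ! q) + \<epsilon> * A $$ (\<alpha> ! p - 1, \<beta> ! q - 1)))"
  have eq: "mult_compound k (1\<^sub>m n + \<epsilon> \<cdot>\<^sub>m A) $$ (i, j) = det (M \<epsilon>)" for \<epsilon>
  proof -
    have "\<alpha> ! p - 1 < n" "\<beta> ! p - 1 < n" if "p < k" for p
      using \<alpha>_range[OF that] \<beta>_range[OF that] by auto
    \<comment> \<open>Truncated subtraction identifies \<open>0\<close> and \<open>1\<close>, so
      positivity of the entries matters here.\<close>
    moreover have "\<alpha> ! p - 1 = \<beta> ! q - 1 \<longleftrightarrow> \<alpha> ! p = \<beta> ! q" if "p < k" "q < k" for p q
      using \<alpha>_range[OF that(1)] \<beta>_range[OF that(2)] by auto
    ultimately show ?thesis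
      using A i j \<alpha>(1) \<beta>(1)
      by (auto simp: mult_compound_def Let_def seq_minor_def M_def simp flip: \<alpha>_def \<beta>_def
          intro!: arg_cong[where f = det] eq_matI)
  qed
  have M0: "M 0 = mat k k (\<lambda>(p, q). of_bool (\<alpha> ! p = \<beta> ! q))"
    by (auto simp: M_def)
  have "((\<lambda>\<epsilon>. det (M \<epsilon>)) has_field_derivative
      (\<Sum>p<k. \<Sum>q<k. A $$ (\<alpha> ! p - 1, \<beta> ! q - 1) * cofactor (M 0) p q)) (at 0)"
    by (rule det_has_field_derivative) (auto simp: M_def intro!: derivative_eq_intros)
  then have "add_compound k A $$ (i, j) =
      (\<Sum>p<k. \<Sum>q<k. A $$ (\<alpha> ! p - 1, \<beta> ! q - 1) * cofactor (M 0) p q)"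
    using A i j by (simp add: add_compound_def Let_def eq DERIV_imp_deriv)
  also have "\<dots> = (\<Sum>p<k. \<Sum>q<k. if set \<alpha> - {\<alpha> ! p} = set \<beta> - {\<beta> ! q}
      then (- 1) ^ (card {z \<in> set \<alpha>. z < \<alpha> ! p} + card {z \<in> set \<beta>. z < \<beta> ! q})
        * A $$ (\<alpha> ! p - 1, \<beta> ! q - 1) else 0)"
    using \<alpha> \<beta> by (auto simp: M0 cofactor_strict_sorted_incidence card_less_nth intro!: sum.cong)
  also have "\<dots> = add_compound_coeff (set \<alpha>) (set \<beta>) A"
  proof -
    have "bij_betw ((!) \<gamma>) {..<k} (set \<gamma>)" if "sorted_wrt (<) \<gamma>" "length \<gamma> = k" for \<gamma> :: "nat list"
      using that by (intro bij_betw_nth) (auto simp: strict_sorted_iff)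
    note reindex = sum.reindex_bij_betw[OF this[OF \<alpha>(3,1)]] sum.reindex_bij_betw[OF this[OF \<beta>(3,1)]]
    show ?thesis
      by (simp only: add_compound_coeff_def flip: reindex)
  qed
  finally show ?thesis
    by (simp add: \<alpha>_def \<beta>_def)
qed

section \<open>Lexicographic order and complementation\<close>

text \<open>Common heads are stripped by induction. A head of \<open>\<beta>\<close> smaller than
  that of \<open>\<alpha>\<close> would lie below \<open>x\<close>, hence in
  \<open>\<alpha>\<close>, against sortedness. The element \<open>y\<close> keeps
  \<open>\<beta>\<close> from being a proper prefix of \<open>\<alpha>\<close>.\<close>

lemma strict_sorted_less_listI:
  fixes \<alpha> \<beta> :: "'a :: linorder list"
  assumes "sorted_wrt (<) \<alpha>" "sorted_wrt (<) \<beta>" "x \<in> set \<alpha>" "x \<notin> set \<beta>"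
    and "\<And>z. z < x \<Longrightarrow> z \<in> set \<alpha> \<longleftrightarrow> z \<in> set \<beta>" and "y \<in> set \<beta>" "x < y"
  shows "\<alpha> < \<beta>"
  using assms
proof (induction \<alpha> arbitrary: \<beta>)
  case (Cons a \<alpha>)
  then obtain b \<beta>' where \<beta>: "\<beta> = b # \<beta>'"
    by (cases \<beta>) auto
  consider "a < b" | "a = b" | "b < a"
    by fastforce
  then show ?case
  proof cases
    case 2
    have "\<alpha> < \<beta>'"
    proof (rule Cons.IH)
      show "z \<in> set \<alpha> \<longleftrightarrow> z \<in> set \<beta>'" if "z < x" for z
        using Cons.prems(1,2) Cons.prems(5)[OF that] by (auto simp: \<beta> 2)
    qed (use Cons.prems 2 in \<open>auto simp: \<beta>\<close>)
    then show ?thesis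
      by (simp add: \<beta> 2)
  next
    case 3
    have "b < x"
      using Cons.prems(1,3) 3 by auto
    then have "b \<in> set (a # \<alpha>)"
      using Cons.prems(5)[of b] by (simp add: \<beta>)
    then show ?thesis
      using Cons.prems(1) 3 by auto
  qed (simp add: \<beta>)
qed simp

lemma finite_min_sym_diff:
  fixes S T :: "'a :: linorder set"
  assumes "finite S" "finite T" "S \<noteq> T"
  obtains x where "x \<in> S - T \<union> (T - S)" "\<And>z. z < x \<Longrightarrow> z \<in> S \<longleftrightarrow> z \<in> T"
proof
  let ?D = "S - T \<union> (T - S)"
  have D: "finite ?D" "?D \<noteq> {}"
    using assms by auto
  then show "Min ?D \<in> ?D"
    by (rule Min_in)
  show "z \<in> S \<longleftrightarrow> z \<in> T" if "z < Min ?D" for z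
    using Min_le[OF D(1), of z] that by force
qed

text \<open>The list without \<open>x\<close> has, by equal length, an element missing from the
  other list. It lies above \<open>x\<close> and serves as the \<open>y\<close> of
  \<open>strict_sorted_less_listI\<close>.\<close>

lemma strict_sorted_less_list_iff:
  fixes \<alpha> \<beta> :: "'a :: linorder list"
  assumes \<alpha>: "sorted_wrt (<) \<alpha>" and \<beta>: "sorted_wrt (<) \<beta>" and len: "length \<alpha> = length \<beta>"
    and x: "x \<in> set \<alpha> - set \<beta> \<union> (set \<beta> - set \<alpha>)"
    and below: "\<And>z. z < x \<Longrightarrow> z \<in> set \<alpha> \<longleftrightarrow> z \<in> set \<beta>"
  shows "\<alpha> < \<beta> \<longleftrightarrow> x \<in> set \<alpha>"
proof -
  have less: "\<gamma> < \<delta>"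
    if \<gamma>: "sorted_wrt (<) \<gamma>" and \<delta>: "sorted_wrt (<) \<delta>" and len: "length \<gamma> = length \<delta>"
      and x: "x \<in> set \<gamma>" "x \<notin> set \<delta>"
      and below: "\<And>z. z < x \<Longrightarrow> z \<in> set \<gamma> \<longleftrightarrow> z \<in> set \<delta>" for \<gamma> \<delta> :: "'a list"
  proof -
    have "card (set \<gamma>) = card (set \<delta>)"
      using \<gamma> \<delta> len by (simp add: strict_sorted_iff distinct_card)
    then have "\<not> set \<delta> \<subseteq> set \<gamma>"
      using x by (metis List.finite_set card_subset_eq)
    then obtain y where y: "y \<in> set \<delta>" "y \<notin> set \<gamma>"
      by auto
    then have "x < y"
      using x below by (metis linorder_neqE)
    then show ?thesis
      using strict_sorted_less_listI[OF \<gamma> \<delta> x below y(1)] by blast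
  qed
  show ?thesis
  proof (cases "x \<in> set \<alpha>")
    case True
    then show ?thesis
      using less[OF \<alpha> \<beta> len] x below by auto
  next
    case False
    then have "\<beta> < \<alpha>"
      using less[OF \<beta> \<alpha> len[symmetric]] x below by auto
    then show ?thesis
      using False by auto
  qed
qed

definition seq_compl :: "nat \<Rightarrow> nat list \<Rightarrow> nat list" where
  "seq_compl n \<alpha> = sorted_list_of_set ({1..n} - set \<alpha>)"

lemma set_seq_compl [simp]: "set (seq_compl n \<alpha>) = {1..n} - set \<alpha>"
  by (simp add: seq_compl_def)

lemma seq_compl_in_inc_seqs:
  assumes "\<alpha> \<in> set (inc_seqs k n)"
  shows "seq_compl n \<alpha> \<in> set (inc_seqs (n - k) n)"
proof -
  have "card (set \<alpha>) = k"
    using assms by (auto simp: set_inc_seqs strict_sorted_iff distinct_card)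
  then show ?thesis
    using assms by (auto simp: set_inc_seqs seq_compl_def card_Diff_subset)
qed

lemma seq_compl_seq_compl:
  assumes "\<alpha> \<in> set (inc_seqs k n)"
  shows "seq_compl n (seq_compl n \<alpha>) = \<alpha>"
  using assms by (intro strict_sorted_equal) (auto simp: set_inc_seqs seq_compl_def)

text \<open>Complements have the same symmetric difference, so the same least element
  \<open>x\<close> decides, but it now belongs to the other list.\<close>

lemma seq_compl_less:
  assumes \<alpha>: "\<alpha> \<in> set (inc_seqs k n)" and \<beta>: "\<beta> \<in> set (inc_seqs k n)" and less: "\<alpha> < \<beta>"
  shows "seq_compl n \<beta> < seq_compl n \<alpha>"
proof -
  have "set \<alpha> \<noteq> set \<beta>"
    using less \<alpha> \<beta> strict_sorted_equal by (fastforce simp: set_inc_seqs)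
  then obtain x where x: "x \<in> set \<alpha> - set \<beta> \<union> (set \<beta> - set \<alpha>)"
    and below: "\<And>z. z < x \<Longrightarrow> z \<in> set \<alpha> \<longleftrightarrow> z \<in> set \<beta>"
    using finite_min_sym_diff[of "set \<alpha>" "set \<beta>"] by auto
  have "x \<in> set \<alpha>"
    using strict_sorted_less_list_iff[of \<alpha> \<beta> x] \<alpha> \<beta> x below less by (simp add: set_inc_seqs)
  then have "x \<in> set (seq_compl n \<beta>) - set (seq_compl n \<alpha>)"
    using x \<alpha> by (auto simp: set_inc_seqs)
  moreover have "z \<in> set (seq_compl n \<beta>) \<longleftrightarrow> z \<in> set (seq_compl n \<alpha>)" if "z < x" for z
    using below[OF that] by auto
  ultimately show ?thesis
    using seq_compl_in_inc_seqs[OF \<alpha>] seq_compl_in_inc_seqs[OF \<beta>]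
      strict_sorted_less_list_iff[of "seq_compl n \<beta>" "seq_compl n \<alpha>" x]
    by (auto simp: set_inc_seqs)
qed

lemma strict_sorted_inc_seqs: "sorted_wrt (<) (inc_seqs k n)"
  by (simp add: inc_seqs_def)

text \<open>Both sides are strictly sorted with the same members: \<open>rev\<close> undoes the
  order reversal, and \<open>seq_compl\<close> is its own inverse.\<close>

lemma inc_seqs_compl:
  assumes "k \<le> n"
  shows "inc_seqs (n - k) n = rev (map (seq_compl n) (inc_seqs k n))"
proof (rule strict_sorted_equal)
  show "sorted_wrt (<) (rev (map (seq_compl n) (inc_seqs k n)))"
    using strict_sorted_inc_seqs[of k n] unfolding sorted_wrt_rev sorted_wrt_map
    by (rule sorted_wrt_mono_rel[rotated]) (rule seq_compl_less)
  have "\<alpha> \<in> seq_compl n ` set (inc_seqs k n)" if "\<alpha> \<in> set (inc_seqs (n - k) n)" for \<alpha>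
    using seq_compl_in_inc_seqs[OF that] seq_compl_seq_compl[OF that] assms
    by (metis diff_diff_cancel imageI)
  then show "set (inc_seqs (n - k) n) = set (rev (map (seq_compl n) (inc_seqs k n)))"
    by (auto intro: seq_compl_in_inc_seqs)
qed (rule strict_sorted_inc_seqs)

lemma inc_seqs_nth_set_eq_iff:
  assumes "i < n choose k" "j < n choose k"
  shows "set (inc_seqs k n ! i) = set (inc_seqs k n ! j) \<longleftrightarrow> i = j"
proof
  assume "set (inc_seqs k n ! i) = set (inc_seqs k n ! j)"
  then have "inc_seqs k n ! i = inc_seqs k n ! j"
    using assms by (intro strict_sorted_equal) (simp_all add: inc_seqs_nth)
  then show "i = j"
    using assms strict_sorted_inc_seqs[of k n]
    by (simp add: strict_sorted_iff nth_eq_iff_index_eq length_inc_seqs)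
qed simp

text \<open>Reversal moves zero-based position \<open>i\<close> to
  \<open>(n choose k) - Suc i\<close>, its partner on the anti-diagonal.\<close>

lemma set_inc_seqs_compl_nth:
  assumes "k \<le> n" "i < n choose k"
  shows "set (inc_seqs (n - k) n ! ((n choose k) - Suc i)) = {1..n} - set (inc_seqs k n ! i)"
proof -
  have "(n choose k) - Suc i < length (inc_seqs k n)"
    unfolding length_inc_seqs using assms(2) by linarith
  then show ?thesis
    using assms by (simp add: inc_seqs_compl rev_nth length_inc_seqs del: One_nat_def)
qed

section \<open>Signs under complementation\<close>

text \<open>The two sets partition \<open>{1..<x}\<close>; the additive form avoids truncated
  subtraction.\<close>

lemma card_less_compl:
  assumes "x \<in> {1..n}" "V \<subseteq> {1..n}"
  shows "card {z \<in> {1..n} - V. z < x} + card {z \<in> V. z < x} + 1 = x"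
proof -
  have fin: "finite V"
    using assms(2) by (rule finite_subset) simp
  have "card ({z \<in> {1..n} - V. z < x} \<union> {z \<in> V. z < x}) =
      card {z \<in> {1..n} - V. z < x} + card {z \<in> V. z < x}"
    using fin by (intro card_Un_disjoint) auto
  moreover have "{z \<in> {1..n} - V. z < x} \<union> {z \<in> V. z < x} = {1..<x}"
    using assms by auto
  ultimately have "card {z \<in> {1..n} - V. z < x} + card {z \<in> V. z < x} = x - 1"
    by simp
  then show ?thesis
    using assms(1) by (metis One_nat_def Suc_eq_plus1 Suc_pred' atLeastAtMost_iff less_eq_Suc_le)
qed

text \<open>
  For \<open>S \<noteq> T\<close> the two sums range over the same pairs: \<open>T = W \<union> {x}\<close> and \<open>S = W \<union> {y}\<close> for a common
  \<open>W\<close>. The rank of \<open>x\<close> in the complement of \<open>S\<close> is \<open>x - 1\<close> minus the rank of \<open>x\<close> in \<open>T\<close>, corrected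
  by one if \<open>y < x\<close>. Exactly one of \<open>y < x\<close> and \<open>x < y\<close> holds, which makes the signs opposite.
\<close>

lemma add_compound_coeff_compl_neq:
  assumes S: "S \<subseteq> {1..n}" and T: "T \<subseteq> {1..n}" and neq: "S \<noteq> T"
  shows "add_compound_coeff T S A +
    (- 1) ^ (\<Sum>S + \<Sum>T) * add_compound_coeff ({1..n} - S) ({1..n} - T) A = (0 :: 'a :: comm_ring_1)"
proof -
  \<comment> \<open>If \<open>x = y\<close>, reinserting it would give \<open>T = S\<close>. The
    sets are arbitrary because the fact is used again for complements.\<close>
  have swap: "x \<notin> S \<and> y \<notin> T \<and> x \<noteq> y"
    if "x \<in> T" "y \<in> S" "T - {x} = S - {y}" "S \<noteq> T" for x y :: nat and S T
    using that by (metis Diff_iff insert_Diff singletonD singletonI)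
  let ?c = "\<lambda>S. {1..n} - S"
  let ?r = "\<lambda>S x. card {z \<in> S. z < x}"
  let ?e = "\<lambda>S T x y. (- 1) ^ (?r S x + ?r T y) * A $$ (x - 1, y - 1)"
  define P where "P = {(x, y). x \<in> T \<and> y \<in> S \<and> T - {x} = S - {y}}"
  have fin: "finite S" "finite T"
    using S T by (auto intro: finite_subset)
  have P_compl: "P = {(x, y). x \<in> ?c S \<and> y \<in> ?c T \<and> ?c S - {x} = ?c T - {y}}"
  proof -
    have "x \<in> ?c S \<and> y \<in> ?c T \<and> ?c S - {x} = ?c T - {y}"
      if "x \<in> T" "y \<in> S" "T - {x} = S - {y}" for x y
      using swap[OF that neq] that S T by blast
    moreover have "x \<in> T \<and> y \<in> S \<and> T - {x} = S - {y}"
      if "x \<in> ?c S" "y \<in> ?c T" "?c S - {x} = ?c T - {y}" for x y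
    proof -
      have "?c T \<noteq> ?c S"
        using neq S T by blast
      then show ?thesis
        using swap[OF that] that S T by blast
    qed
    ultimately have "x \<in> T \<and> y \<in> S \<and> T - {x} = S - {y} \<longleftrightarrow>
        x \<in> ?c S \<and> y \<in> ?c T \<and> ?c S - {x} = ?c T - {y}" for x y
      by iprover
    then show ?thesis
      by (simp only: P_def)
  qed
  have coeff: "add_compound_coeff S T A = (\<Sum>(x, y)\<in>{(x, y). x \<in> S \<and> y \<in> T \<and> S - {x} = T - {y}}. ?e S T x y)"
    if "finite S" "finite T" for S T
  proof -
    have "add_compound_coeff S T A = (\<Sum>(x, y)\<in>S \<times> T. if S - {x} = T - {y} then ?e S T x y else 0)"
      by (simp add: add_compound_coeff_def sum.cartesian_product)
    also have "\<dots> = (\<Sum>(x, y)\<in>{z \<in> S \<times> T. S - {fst z} = T - {snd z}}. ?e S T x y)"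
      using that by (simp add: sum.inter_filter split_beta del: One_nat_def)
    also have "{z \<in> S \<times> T. S - {fst z} = T - {snd z}} =
        {(x, y). x \<in> S \<and> y \<in> T \<and> S - {x} = T - {y}}"
      by (rule Set.set_eqI) (simp add: split_beta mem_Times_iff)
    finally show ?thesis .
  qed
  have sign: "?e T S x y + (- 1) ^ (\<Sum>S + \<Sum>T) * ?e (?c S) (?c T) x y = 0" if "(x, y) \<in> P" for x y
  proof -
    have xy: "x \<in> T" "y \<in> S" "T - {x} = S - {y}"
      using that by (auto simp: P_def)
    note notin = swap[OF this neq]
    define W where "W = S - {y}"
    have W: "S = insert y W" "T = insert x W" "x \<notin> W" "y \<notin> W" "finite W"
      using xy notin fin by (auto simp: W_def)
    have range: "x \<in> {1..n}" "y \<in> {1..n}"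
      using xy S T by auto
    have sums: "\<Sum>S = y + \<Sum>W" "\<Sum>T = x + \<Sum>W"
      using W by simp_all
    have insert_eq: "{z \<in> insert u W. z < v} = (if u < v then insert u {z \<in> W. z < v} else {z \<in> W. z < v})"
      for u v
      by auto
    have ranks: "?r T x = ?r W x" "?r S x = ?r W x + of_bool (y < x)"
      "?r S y = ?r W y" "?r T y = ?r W y + of_bool (x < y)"
      using W by (simp_all add: insert_eq del: insert_iff)
    \<comment> \<open>Each use of \<open>card_less_compl\<close> contributes \<open>1\<close>; the
      third unit comes from whichever of \<open>x < y\<close> and \<open>y < x\<close>
      holds.\<close>
    have "x + y = ?r (?c S) x + ?r (?c T) y + ?r W x + ?r W y + 3"
      using card_less_compl[OF range(1) S] card_less_compl[OF range(2) T] ranks notin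
      by (cases "x < y") auto
    then have "\<Sum>S + \<Sum>T + (?r (?c S) x + ?r (?c T) y) =
        (?r T x + ?r S y) + 1 + 2 * (\<Sum>W + 1 + ?r (?c S) x + ?r (?c T) y)"
      unfolding sums ranks by simp
    then have "(- 1 :: 'a) ^ (\<Sum>S + \<Sum>T) * (- 1) ^ (?r (?c S) x + ?r (?c T) y) =
        - ((- 1) ^ (?r T x + ?r S y))"
      unfolding power_add[symmetric] by (simp add: power_add power_mult)
    then show ?thesis
      by (simp add: mult.assoc[symmetric])
  qed
  have "add_compound_coeff T S A = (\<Sum>(x, y)\<in>P. ?e T S x y)"
    using coeff[OF fin(2,1)] by (simp only: P_def)
  moreover have "add_compound_coeff (?c S) (?c T) A = (\<Sum>(x, y)\<in>P. ?e (?c S) (?c T) x y)"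
    unfolding P_compl by (rule coeff) simp_all
  ultimately have "add_compound_coeff T S A + (- 1) ^ (\<Sum>S + \<Sum>T) * add_compound_coeff (?c S) (?c T) A =
      (\<Sum>(x, y)\<in>P. ?e T S x y + (- 1) ^ (\<Sum>S + \<Sum>T) * ?e (?c S) (?c T) x y)"
    by (simp only: sum_distrib_left sum.distrib case_prod_unfold)
  also have "\<dots> = 0"
    using sign by (intro sum.neutral) auto
  finally show ?thesis .
qed

text \<open>Removing different elements of \<open>S\<close> leaves different sets, so only
  \<open>y = x\<close> survives, with an even exponent in its sign.\<close>

lemma add_compound_coeff_self:
  assumes "finite S"
  shows "add_compound_coeff S S A = (\<Sum>x\<in>S. A $$ (x - 1, x - 1))"
  unfolding add_compound_coeff_def
proof (intro sum.cong refl)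
  fix x assume x: "x \<in> S"
  have "(\<Sum>y\<in>S. if S - {x} = S - {y}
      then (- 1) ^ (card {z \<in> S. z < x} + card {z \<in> S. z < y}) * A $$ (x - 1, y - 1) else 0) =
      (\<Sum>y\<in>S. if y = x then A $$ (x - 1, y - 1) else 0)"
    using x by (intro sum.cong refl) (auto simp flip: mult_2)
  then show "(\<Sum>y\<in>S. if S - {x} = S - {y}
      then (- 1) ^ (card {z \<in> S. z < x} + card {z \<in> S. z < y}) * A $$ (x - 1, y - 1) else 0) =
      A $$ (x - 1, x - 1)"
    using x assms by simp
qed

section \<open>Conjugation by the signed anti-diagonal matrix\<close>

text \<open>Column \<open>l\<close> of the anti-diagonal matrix is supported in row
  \<open>(n choose k) - Suc l\<close>, so each of the two product sums collapses to one
  term.\<close>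

lemma signed_antidiag_conj_index:
  assumes M: "M \<in> carrier_mat (n choose k) (n choose k)" and i: "i < n choose k" and j: "j < n choose k"
  shows "(transpose_mat (signed_antidiag k n) * M * signed_antidiag k n) $$ (i, j) =
    seq_sign (inc_seqs k n ! i) * seq_sign (inc_seqs k n ! j)
      * M $$ ((n choose k) - Suc i, (n choose k) - Suc j)"
proof -
  let ?r = "n choose k" and ?U = "signed_antidiag k n" and ?s = "\<lambda>l. seq_sign (inc_seqs k n ! l)"
  have U: "?U $$ (p, l) = (if p = ?r - Suc l then ?s l else 0)" if "p < ?r" "l < ?r" for p l
    using that by (auto simp: signed_antidiag_def Let_def)
  have dim_U: "dim_row ?U = ?r" "dim_col ?U = ?r"
    by (simp_all add: signed_antidiag_def Let_def)
  have left: "(transpose_mat ?U * M) $$ (i, q) = ?s i * M $$ (?r - Suc i, q)" if "q < ?r" for q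
  proof -
    have "(transpose_mat ?U * M) $$ (i, q) = (\<Sum>p = 0..<?r. ?U $$ (p, i) * M $$ (p, q))"
      using M i that dim_U by (simp add: scalar_prod_def)
    also have "\<dots> = (\<Sum>p = 0..<?r. if p = ?r - Suc i then ?s i * M $$ (p, q) else 0)"
      using i by (intro sum.cong) (simp_all add: U)
    finally show ?thesis
      using i by simp
  qed
  have "(transpose_mat ?U * M * ?U) $$ (i, j) = (\<Sum>q = 0..<?r. (transpose_mat ?U * M) $$ (i, q) * ?U $$ (q, j))"
    using M i j dim_U by (simp add: scalar_prod_def)
  also have "\<dots> = (\<Sum>q = 0..<?r. if q = ?r - Suc j then ?s i * M $$ (?r - Suc i, q) * ?s j else 0)"
    using j by (intro sum.cong) (simp_all add: U left)
  finally show ?thesis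
    using j by simp
qed

theorem theorem11:
  fixes n k :: nat and A :: "complex mat"
  assumes "n \<ge> 2" and "k \<in> {1..n - 1}" and "A \<in> carrier_mat n n"
  shows "transpose_mat (add_compound k A)
           + transpose_mat (signed_antidiag k n) * add_compound (n - k) A * signed_antidiag k n
         = mat_trace A \<cdot>\<^sub>m 1\<^sub>m (n choose k)"
proof (rule eq_matI)
  let ?r = "n choose k" and ?U = "signed_antidiag k n" and ?N = "add_compound (n - k) A"
  have k: "k \<le> n"
    using assms(2) by auto
  have N: "?N \<in> carrier_mat ?r ?r"
    using assms(3) k by (simp add: add_compound_def binomial_symmetric[symmetric])
  have dim_K: "dim_row (add_compound k A) = ?r" "dim_col (add_compound k A) = ?r"
    using assms(3) by (simp_all add: add_compound_def)
  have dim_U: "dim_row ?U = ?r" "dim_col ?U = ?r"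
    by (simp_all add: signed_antidiag_def Let_def)
  fix i j
  assume "i < dim_row (mat_trace A \<cdot>\<^sub>m 1\<^sub>m ?r)" "j < dim_col (mat_trace A \<cdot>\<^sub>m 1\<^sub>m ?r)"
  then have ij: "i < ?r" "j < ?r"
    by simp_all
  define S T where "S = set (inc_seqs k n ! i)" and "T = set (inc_seqs k n ! j)"
  have S: "S \<subseteq> {1..n}" and T: "T \<subseteq> {1..n}"
    using ij inc_seqs_nth by (simp_all add: S_def T_def)
  \<comment> \<open>Strictly increasing lists are distinct, so their list sum is the sum over their
    set.\<close>
  have sign: "seq_sign (inc_seqs k n ! l) = (- 1) ^ \<Sum>(set (inc_seqs k n ! l))" if "l < ?r" for l
    using inc_seqs_nth(3)[OF that] by (simp add: seq_sign_def strict_sorted_iff distinct_sum_list_conv_Sum)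
  have "(transpose_mat ?U * ?N * ?U) $$ (i, j) =
      (- 1) ^ (\<Sum>S + \<Sum>T) * ?N $$ (?r - Suc i, ?r - Suc j)"
    using signed_antidiag_conj_index[OF N ij] ij by (simp add: sign S_def T_def power_add)
  also have "?N $$ (?r - Suc i, ?r - Suc j) = add_compound_coeff ({1..n} - S) ({1..n} - T) A"
    using ij k unfolding S_def T_def
    by (subst add_compound_index[OF assms(3)])
      (simp_all add: set_inc_seqs_compl_nth binomial_symmetric[symmetric]
        del: One_nat_def)
  \<comment> \<open>Transposition puts \<open>T\<close> first in the first coefficient, while the
    conjugated term keeps the order of \<open>S\<close> and \<open>T\<close>.\<close>
  finally have "(transpose_mat (add_compound k A) + transpose_mat ?U * ?N * ?U) $$ (i, j) =
      add_compound_coeff T S A + (- 1) ^ (\<Sum>S + \<Sum>T) * add_compound_coeff ({1..n} - S) ({1..n} - T) A"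
    using ij dim_K dim_U assms(3) by (simp add: add_compound_index S_def T_def)
  also have "\<dots> = (mat_trace A \<cdot>\<^sub>m 1\<^sub>m ?r) $$ (i, j)"
  proof (cases "i = j")
    case True
    then have "T = S"
      by (simp add: S_def T_def)
    have fin: "finite S"
      using S by (rule finite_subset) simp
    have "(\<Sum>x\<in>S. A $$ (x - 1, x - 1)) + (\<Sum>x\<in>{1..n} - S. A $$ (x - 1, x - 1)) =
        (\<Sum>x\<in>{1..n}. A $$ (x - 1, x - 1))"
      using sum.subset_diff[OF S, of "\<lambda>x. A $$ (x - 1, x - 1)"] by (simp add: add.commute)
    \<comment> \<open>The index shift passes from one-based elements to the zero-based
      diagonal.\<close>
    also have "\<dots> = mat_trace A"
      using assms(3) sum.shift_bounds_Suc_ivl[of "\<lambda>x. A $$ (x - 1, x - 1)" 0 n]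
      by (simp add: mat_trace_def atLeastLessThanSuc_atLeastAtMost atLeast0LessThan)
    finally show ?thesis
      using ij True
      by (simp add: \<open>T = S\<close> add_compound_coeff_self fin power_add
          flip: power_mult_distrib del: One_nat_def)
  next
    case False
    then have "S \<noteq> T"
      using ij by (simp add: S_def T_def inc_seqs_nth_set_eq_iff)
    then show ?thesis
      using False ij add_compound_coeff_compl_neq[OF S T] by simp
  qed
  finally show "(transpose_mat (add_compound k A) + transpose_mat ?U * ?N * ?U) $$ (i, j) =
      (mat_trace A \<cdot>\<^sub>m 1\<^sub>m ?r) $$ (i, j)" .
qed (simp_all add: signed_antidiag_def Let_def)

end
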